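(* There exist universal constants $c,c'>0$ such that for all positive integers $m,B$ with $B\leq cm^2$ and for any budgeted algorithm with budget $B$, there are an $m\times m$ kernel matrix $K$ (belonging to $\mathcal{K}_{2d,m}$ for some appropriate $d$) and target values $y_1,\dots,y_m\in[-1,+1]$ such that the coefficient vector $\boldsymbol{\alpha}\in\mathbb{R}^m$ returned by the algorithm satisfies \[ \left(\frac{1}{m}\sum_{t=1}^{m}\left|\boldsymbol{\alpha}^\top K \boldsymbol{e}_t-y_t\right|\right) -\min_{\boldsymbol{a}\in\mathbb{R}^m\,:\,\boldsymbol{a}^\top K \boldsymbol{a}\leq 2}\ \frac{1}{m}\sum_{t=1}^{m}\left|\boldsymbol{a}^\top K \boldsymbol{e}_t-y_t\right| \;\geq\; \frac{c'}{\sqrt[4]{B}}~. \]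
   Context: $\boldsymbol{e}_1,\dots,\boldsymbol{e}_m$ is the standard basis of $\mathbb{R}^m$. Class $\mathcal{K}_{d,m}$: let $\mathcal{K}'_{d,m}$ be the class of all block-diagonal $m\times m$ matrices composed of at most $d$ (square, diagonal) blocks, with all entries equal to $1$ within each block and $0$ outside the blocks. Then $\mathcal{K}_{d,m}$ is the set of $K\in\{0,1\}^{m\times m}$ for which there exist a permutation $\pi$ of $\{1,\dots,m\}$ and $K'\in\mathcal{K}'_{d,m}$ with $K_{i,j}=K'_{\pi(i),\pi(j)}$ for all $i,j$. The class $\mathcal{K}_{2d,m}$ is the one with $2d$ in place of $d$. Budgeted algorithm: the algorithm is given the target values $y_1,\dots,y_m$ but not the kernel matrix $K$. It may (adaptively) query at most $B$ entries of $K$, and then returns a coefficient vector $\boldsymbol{\alpha}\in\mathbb{R}^m$ based on this information. If the algorithm is randomized, the error of the returned vector is understood in expectation over the algorithm's internal randomness. *)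

theory Defs
  imports "HOL-Probability.Probability_Measure" "Jordan_Normal_Form.Matrix"
begin

text \<open>
  Both imports provide a type of vectors. The Cartesian-product one is hidden, so that
  \<open>vec\<close>, \<open>$\<close> and \<open>\<bullet>\<close> refer to vectors and matrices whose dimension is a natural number.
  Coordinates are numbered from 0, so the standard basis of $R^m$ is
  \<open>unit_vec m 0, \<dots>, unit_vec m (m - 1)\<close>.
\<close>

hide_type (open) Finite_Cartesian_Product.vec
hide_const (open) Finite_Cartesian_Product.vec Finite_Cartesian_Product.mat
no_notation vec_nth (infixl \<open>$\<close> 90)
no_notation inner (infix \<open>\<bullet>\<close> 70)

definition block_kernels :: "nat \<Rightarrow> nat \<Rightarrow> real mat set" where
  "block_kernels d m =
     {diag_block_mat (map (\<lambda>n. mat n n (\<lambda>_. 1)) ns) | ns.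
        length ns \<le> d \<and> (\<forall>n\<in>set ns. n > 0) \<and> sum_list ns = m}"

definition cluster_kernels :: "nat \<Rightarrow> nat \<Rightarrow> real mat set" where
  "cluster_kernels d m =
     {K \<in> carrier_mat m m. elements_mat K \<subseteq> {0, 1} \<and>
        (\<exists>\<pi> K'. \<pi> permutes {..<m} \<and> K' \<in> block_kernels d m \<and>
           (\<forall>i<m. \<forall>j<m. K $$ (i, j) = K' $$ (\<pi> i, \<pi> j)))}"

text \<open>
  A deterministic adaptive procedure: either it stops and outputs a coefficient vector, or it
  queries the entry at position \<open>(i, j)\<close> and continues in a way that depends on the answer.
  The kernel matrix influences the output only through the answers to the queries.
\<close>

datatype query_tree = Return "real vec" | Query nat nat "real \<Rightarrow> query_tree"

primrec run :: "query_tree \<Rightarrow> real mat \<Rightarrow> real vec" where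
  "run (Return \<alpha>) K = \<alpha>"
| "run (Query i j f) K = run (f (K $$ (i, j))) K"

text \<open>At most \<open>B\<close> queries, all inside the matrix, and an output vector of dimension \<open>m\<close>.\<close>

inductive budgeted :: "nat \<Rightarrow> nat \<Rightarrow> query_tree \<Rightarrow> bool" for m where
  "\<alpha> \<in> carrier_vec m \<Longrightarrow> budgeted m B (Return \<alpha>)"
| "i < m \<Longrightarrow> j < m \<Longrightarrow> (\<And>x. budgeted m B (f x)) \<Longrightarrow> budgeted m (Suc B) (Query i j f)"

text \<open>
  A deterministic algorithm maps the target values, which it knows from the start, to a query
  tree. A randomized algorithm is a probability distribution over deterministic ones: all
  internal randomness may be drawn before the first query. Putting the measure on the
  algorithms themselves, instead of on a seed space, loses no generality, since a seeded
  algorithm has a push-forward measure, and it avoids a type variable for seeds, on which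
  constants quantified outside the algorithm could otherwise depend. Measurability is required only of
  the output coordinates; the sigma-algebra is otherwise arbitrary. A deterministic algorithm
  is the case where the space of \<open>M\<close> is a singleton.
\<close>

definition budgeted_algorithm :: "nat \<Rightarrow> nat \<Rightarrow> (real vec \<Rightarrow> query_tree) measure \<Rightarrow> bool" where
  "budgeted_algorithm m B M \<longleftrightarrow>
     prob_space M \<and>
     (\<forall>A\<in>space M. \<forall>y\<in>carrier_vec m. budgeted m B (A y)) \<and>
     (\<forall>y\<in>carrier_vec m. \<forall>K\<in>carrier_mat m m. \<forall>i<m.
        (\<lambda>A. run (A y) K $ i) \<in> borel_measurable M)"

definition avg_loss :: "nat \<Rightarrow> real mat \<Rightarrow> real vec \<Rightarrow> real vec \<Rightarrow> real" where
  "avg_loss m K y \<alpha> = (1 / real m) * (\<Sum>t<m. \<bar>\<alpha> \<bullet> (K *\<^sub>v unit_vec m t) - y $ t\<bar>)"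

text \<open>The expected loss may be infinite, hence it is a nonnegative integral in \<open>ennreal\<close>.\<close>

definition expected_loss ::
    "nat \<Rightarrow> (real vec \<Rightarrow> query_tree) measure \<Rightarrow> real mat \<Rightarrow> real vec \<Rightarrow> ennreal" where
  "expected_loss m M K y = (\<integral>\<^sup>+ A. ennreal (avg_loss m K y (run (A y) K)) \<partial>M)"

text \<open>
  For kernel matrices the infimum is attained: the loss and the constraint depend on \<open>a\<close>
  only through its sums over the clusters, and the constraint bounds these sums.
\<close>

definition best_loss :: "nat \<Rightarrow> real mat \<Rightarrow> real vec \<Rightarrow> real" where
  "best_loss m K y = (INF a\<in>{a \<in> carrier_vec m. a \<bullet> (K *\<^sub>v a) \<le> 2}. avg_loss m K y a)"

end

theory Submission
  imports Defs
begin

text \<open>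
  Only the \<open>2 n\<close> residue classes of the points matter, with \<open>n\<close> of order \<open>sqrt B\<close>; call the
  classes below \<open>n\<close> roots and the others leaves. Each leaf \<open>v\<close> draws a random root \<open>x v\<close>, and a
  random set \<open>S\<close> of leaves is attached to the roots drawn, while the other leaves stay alone. All
  targets equal \<open>\<beta> = 1 / sqrt n\<close>, so that some admissible coefficient vector has loss 0.

  Attach a further leaf \<open>v\<close> to its root \<open>u\<close>. Unless the algorithm has queried an entry between the
  two clusters, its output does not change, the predictions \<open>p\<close> on \<open>v\<close> and \<open>q\<close> on \<open>u\<close> become
  \<open>p + q\<close>, and \<open>\<bar>p - \<beta>\<bar> + \<bar>q - \<beta>\<bar> + \<bar>p + q - \<beta>\<bar> \<ge> \<beta>\<close>. As long as \<open>v\<close> is alone, the kernel does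
  not depend on \<open>x v\<close>, so the root may be redrawn afterwards: this spreads the loss on \<open>u\<close> evenly
  over all roots and shows that at most \<open>B / n\<close> leaves are queried against their root on average.
\<close>

section \<open>Cluster kernels of labellings\<close>

text \<open>Describing a kernel by labels instead of blocks turns the merging of two clusters into a
  relabelling.\<close>

definition label_kernel :: "nat \<Rightarrow> (nat \<Rightarrow> 'a) \<Rightarrow> real mat" where
  "label_kernel m f = mat m m (\<lambda>(i, j). of_bool (f i = f j))"

text \<open>This number is the prediction of \<alpha> at every point labelled
  \<open>l\<close>.\<close>

definition cluster_sum :: "nat \<Rightarrow> (nat \<Rightarrow> 'a) \<Rightarrow> real vec \<Rightarrow> 'a \<Rightarrow> real" where
  "cluster_sum m f \<alpha> l = (\<Sum>i | i < m \<and> f i = l. \<alpha> $ i)"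

lemma label_kernel_carrier [simp]: "label_kernel m f \<in> carrier_mat m m"
  by (simp add: label_kernel_def)

lemma label_kernel_index [simp]:
  "i < m \<Longrightarrow> j < m \<Longrightarrow> label_kernel m f $$ (i, j) = of_bool (f i = f j)"
  by (simp add: label_kernel_def)

lemma scalar_prod_label_kernel:
  assumes "t < m"
  shows "\<alpha> \<bullet> (label_kernel m f *\<^sub>v unit_vec m t) = cluster_sum m f \<alpha> (f t)"
proof -
  have "label_kernel m f *\<^sub>v unit_vec m t = vec m (\<lambda>i. of_bool (f i = f t))"
    using assms by (intro eq_vecI) (auto simp: label_kernel_def)
  then have "\<alpha> \<bullet> (label_kernel m f *\<^sub>v unit_vec m t) = (\<Sum>i<m. \<alpha> $ i * of_bool (f i = f t))"
    by (auto simp: scalar_prod_def atLeast0LessThan)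
  also have "\<dots> = (\<Sum>i<m. if f i = f t then \<alpha> $ i else 0)"
    by (intro sum.cong) auto
  also have "\<dots> = cluster_sum m f \<alpha> (f t)"
    unfolding cluster_sum_def by (subst sum.inter_filter [symmetric]) auto
  finally show ?thesis .
qed

text \<open>Equal entries of a sorted list are contiguous, so the initial run of equal entries is
  the first block. The induction is on the length because what remains is a suffix that may be
  shorter than the tail.\<close>

lemma block_kernel_of_sorted:
  fixes zs :: "'a::linorder list"
  assumes "sorted zs"
  shows "\<exists>ns. (\<forall>n\<in>set ns. n > 0) \<and> sum_list ns = length zs \<and>
    diag_block_mat (map (\<lambda>n. mat n n (\<lambda>_. 1)) ns) = label_kernel (length zs) ((!) zs)"
  using assms
proof (induction zs rule: length_induct)
  case (1 zs)
  show ?case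
  proof (cases zs)
    case Nil
    then show ?thesis
      by (intro exI [of _ "[]"]) (auto simp: label_kernel_def)
  next
    case (Cons a rest)
    define us where "us = takeWhile (\<lambda>z. z = a) zs"
    define vs where "vs = dropWhile (\<lambda>z. z = a) zs"
    have zs: "zs = us @ vs" by (simp add: us_def vs_def)
    have us: "us ! i = a" if "i < length us" for i
    proof -
      have "us ! i \<in> set us" using that by simp
      then show ?thesis unfolding us_def using set_takeWhileD by fastforce
    qed
    have pos: "length us > 0" using Cons by (simp add: us_def)
    have vs: "sorted vs" using \<open>sorted zs\<close> by (simp add: zs sorted_append)
    \<comment> \<open>The head of \<open>vs\<close> differs from \<open>a\<close> and is at least
      \<open>a\<close>, and the rest of \<open>vs\<close> is at least that head, so \<open>a\<close>
      never recurs.\<close>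
    have "z \<noteq> a" if "z \<in> set vs" for z
    proof -
      have "vs \<noteq> []" using that by auto
      then have "hd vs \<noteq> a" unfolding vs_def using hd_dropWhile [of "\<lambda>z. z = a" zs] by blast
      moreover have "a \<le> hd vs"
      proof -
        have "hd vs \<in> set zs" using \<open>vs \<noteq> []\<close> by (simp add: zs)
        then show ?thesis using \<open>sorted zs\<close> Cons by auto
      qed
      moreover have "hd vs \<le> z"
        using vs that by (cases vs) auto
      ultimately show ?thesis by auto
    qed
    then have vsa: "vs ! i \<noteq> a" if "i < length vs" for i using that by auto
    have "length vs < length zs" using pos zs by simp
    with 1 vs obtain ns where ns: "\<forall>n\<in>set ns. n > 0" "sum_list ns = length vs"
      "diag_block_mat (map (\<lambda>n. mat n n (\<lambda>_. 1)) ns) = label_kernel (length vs) ((!) vs)"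
      by blast
    show ?thesis
    proof (intro exI conjI)
      show "\<forall>n\<in>set (length us # ns). n > 0" using ns pos by simp
      show "sum_list (length us # ns) = length zs" using ns zs by simp
      show "diag_block_mat (map (\<lambda>n. mat n n (\<lambda>_. 1)) (length us # ns))
          = label_kernel (length zs) ((!) zs)"
      proof (rule eq_matI)
        fix i j assume "i < dim_row (label_kernel (length zs) ((!) zs))"
          "j < dim_col (label_kernel (length zs) ((!) zs))"
        then have "i < length us + length vs" "j < length us + length vs"
          by (simp_all add: label_kernel_def zs)
        moreover have "i - length us < length vs" if "\<not> i < length us" using that calculation by simp
        moreover have "j - length us < length vs" if "\<not> j < length us" using that calculation by simp
        ultimately show "diag_block_mat (map (\<lambda>n. mat n n (\<lambda>_. 1)) (length us # ns)) $$ (i, j)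
            = label_kernel (length zs) ((!) zs) $$ (i, j)"
          using vsa [of "i - length us"] vsa [of "j - length us"]
          by (auto simp: Let_def ns(3) zs nth_append us label_kernel_def)
      qed (simp_all add: Let_def ns(3) zs label_kernel_def)
    qed
  qed
qed

text \<open>Sorting the labels supplies the permutation. The blocks are nonempty, so there are at
  most \<open>m\<close> of them.\<close>

lemma label_kernel_in_cluster_kernels:
  fixes f :: "nat \<Rightarrow> 'a::linorder"
  assumes "m \<le> d"
  shows "label_kernel m f \<in> cluster_kernels d m"
proof -
  define zs where "zs = sort (map f [0..<m])"
  obtain ns where ns: "\<forall>n\<in>set ns. n > 0" "sum_list ns = m"
    "diag_block_mat (map (\<lambda>n. mat n n (\<lambda>_. 1)) ns) = label_kernel m ((!) zs)"
    using block_kernel_of_sorted [of zs] by (auto simp: zs_def)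
  have "length ns \<le> sum_list ns"
    using ns(1) by (induction ns) auto
  then have block: "label_kernel m ((!) zs) \<in> block_kernels d m"
    unfolding block_kernels_def using ns assms by (intro CollectI exI [of _ ns]) auto
  have "mset (map f [0..<m]) = mset zs"
    by (simp add: zs_def)
  then obtain \<pi> where \<pi>: "\<pi> permutes {..<length zs}" "permute_list \<pi> zs = map f [0..<m]"
    by (rule mset_eq_permutation)
  have len: "length zs = m" by (simp add: zs_def)
  have f: "f i = zs ! \<pi> i" if "i < m" for i
    using permute_list_nth [OF \<pi>(1), of i] that \<pi>(2) by (simp add: len)
  have "\<pi> i < m" if "i < m" for i
    using \<pi>(1) that permutes_in_image [of \<pi> "{..<m}" i] by (simp add: len)
  then have "\<forall>i<m. \<forall>j<m. label_kernel m f $$ (i, j) = label_kernel m ((!) zs) $$ (\<pi> i, \<pi> j)"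
    by (simp add: f)
  moreover have "elements_mat (label_kernel m f) \<subseteq> {0, 1}"
    by (auto simp: elements_mat_def label_kernel_def)
  ultimately show ?thesis
    unfolding cluster_kernels_def using block \<pi>(1) len by auto
qed

section \<open>Query trees\<close>

primrec queries :: "query_tree \<Rightarrow> real mat \<Rightarrow> (nat \<times> nat) list" where
  "queries (Return \<alpha>) K = []"
| "queries (Query i j f) K = (i, j) # queries (f (K $$ (i, j))) K"

text \<open>Agreement on the entries asked under \<open>K\<close> is enough: equal answers keep both
  runs on the same branch of the tree.\<close>

lemma run_cong_queries:
  assumes "\<And>p. p \<in> set (queries T K) \<Longrightarrow> K' $$ p = K $$ p"
  shows "run T K' = run T K"
  using assms by (induction T) auto

lemma budgeted_queries:
  assumes "budgeted m B T"
  shows "length (queries T K) \<le> B" "set (queries T K) \<subseteq> {..<m} \<times> {..<m}" "run T K \<in> carrier_vec m"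
  using assms by (induction rule: budgeted.induct) auto

section \<open>The family of hard kernels\<close>

definition attach :: "(nat \<Rightarrow> nat) \<Rightarrow> nat set \<Rightarrow> nat \<Rightarrow> nat" where
  "attach x S w = (if w \<in> S then x w else w)"

text \<open>Exchanging \<open>x v\<close> with \<open>u\<close> is an involution on the pairs
  \<open>(x, u)\<close>, and \<open>F x\<close> does not see the coordinate \<open>v\<close>. This
  is the redrawing of the root of a lone leaf.\<close>

lemma sum_PiE_resample:
  fixes F :: "('a \<Rightarrow> 'b) \<Rightarrow> 'b \<Rightarrow> real"
  assumes "v \<in> V" and F: "\<And>x u. x \<in> V \<rightarrow>\<^sub>E C \<Longrightarrow> u \<in> C \<Longrightarrow> F (x(v := u)) = F x"
  shows "real (card C) * (\<Sum>x\<in>V \<rightarrow>\<^sub>E C. F x (x v)) = (\<Sum>x\<in>V \<rightarrow>\<^sub>E C. \<Sum>u\<in>C. F x u)"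
proof -
  have "(\<Sum>x\<in>V \<rightarrow>\<^sub>E C. \<Sum>u\<in>C. F x u) = (\<Sum>(x, u)\<in>(V \<rightarrow>\<^sub>E C) \<times> C. F x u)"
    by (rule sum.cartesian_product)
  also have "\<dots> = (\<Sum>(x, u)\<in>(V \<rightarrow>\<^sub>E C) \<times> C. F x (x v))"
    using assms
    by (intro sum.reindex_bij_witness [of _ "\<lambda>(x, u). (x(v := u), x v)" "\<lambda>(x, u). (x(v := u), x v)"])
      (auto simp: PiE_iff extensional_def)
  also have "\<dots> = (\<Sum>x\<in>V \<rightarrow>\<^sub>E C. \<Sum>u\<in>C. F x (x v))"
    by (rule sum.cartesian_product [symmetric])
  finally show ?thesis by (simp add: sum_distrib_left)
qed

text \<open>Pairs \<open>(S, v)\<close> with \<open>v\<close> outside \<open>S\<close> correspond to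
  pairs with \<open>v\<close> inside by inserting \<open>v\<close>. Letting \<open>S\<close> range
  over all subsets makes a loss after attachment a loss of another member of the same
  family.\<close>

lemma sum_Pow_insert:
  fixes G :: "'a set \<Rightarrow> 'a \<Rightarrow> real"
  assumes "finite V"
  shows "(\<Sum>S\<in>Pow V. \<Sum>v\<in>V - S. G (insert v S) v) = (\<Sum>S\<in>Pow V. \<Sum>v\<in>S. G S v)"
proof -
  have "(\<Sum>S\<in>Pow V. \<Sum>v\<in>V - S. G (insert v S) v)
      = (\<Sum>(S, v)\<in>Sigma (Pow V) (\<lambda>S. V - S). G (insert v S) v)"
    using assms by (intro sum.Sigma) auto
  also have "\<dots> = (\<Sum>(S, v)\<in>Sigma (Pow V) (\<lambda>S. S). G S v)"
    by (intro sum.reindex_bij_witness [of _ "\<lambda>(S, v). (S - {v}, v)" "\<lambda>(S, v). (insert v S, v)"])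
      auto
  also have "\<dots> = (\<Sum>S\<in>Pow V. \<Sum>v\<in>S. G S v)"
    using assms by (intro sum.Sigma [symmetric]) (auto intro: finite_subset)
  finally show ?thesis .
qed

text \<open>Complementation pairs the subsets, so on average half of \<open>V\<close> is left
  out.\<close>

lemma sum_card_Diff_Pow:
  assumes "finite V"
  shows "2 * (\<Sum>S\<in>Pow V. real (card (V - S))) = real (card V) * real (card (Pow V))"
proof -
  have "(\<Sum>S\<in>Pow V. real (card (V - S))) = (\<Sum>S\<in>Pow V. real (card S))"
    by (intro sum.reindex_bij_witness [of _ "\<lambda>S. V - S" "\<lambda>S. V - S"]) auto
  then have "2 * (\<Sum>S\<in>Pow V. real (card (V - S))) = (\<Sum>S\<in>Pow V. real (card (V - S)) + real (card S))"
    by (simp add: sum.distrib)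
  also have "\<dots> = (\<Sum>S\<in>Pow V. real (card V))"
    using assms
    by (intro sum.cong refl) (auto simp: card_Diff_subset finite_subset card_mono of_nat_diff)
  finally show ?thesis by simp
qed

text \<open>Only the complete periods of length \<open>N\<close> are counted; the remainder
  contributes a nonnegative amount.\<close>

lemma sum_mod_ge:
  fixes g :: "nat \<Rightarrow> real"
  assumes "\<And>w. g w \<ge> 0"
  shows "real (m div N) * (\<Sum>w<N. g w) \<le> (\<Sum>t<m. g (t mod N))"
proof -
  have "real (m div N) * (\<Sum>w<N. g w) = (\<Sum>k<m div N. \<Sum>w<N. g w)"
    by simp
  also have "\<dots> = (\<Sum>k<m div N. \<Sum>t=k*N..<k*N+N. g (t mod N))"
  proof (rule sum.cong [OF refl])
    fix k
    show "(\<Sum>w<N. g w) = (\<Sum>t=k*N..<k*N+N. g (t mod N))"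
      by (intro sum.reindex_bij_witness [of _ "\<lambda>t. t - k * N" "\<lambda>w. w + k * N"])
        (auto simp: less_diff_conv2)
  qed
  also have "\<dots> = (\<Sum>t<m div N * N. g (t mod N))"
    by (rule sum.nat_group)
  also have "\<dots> \<le> (\<Sum>t<m. g (t mod N))"
    using assms by (intro sum_mono2) (auto intro: order_less_le_trans)
  finally show ?thesis .
qed


section \<open>Attaching one leaf: the effect on the loss and its average\<close>

definition node_label :: "nat \<Rightarrow> (nat \<Rightarrow> nat) \<Rightarrow> nat set \<Rightarrow> nat \<Rightarrow> nat" where
  "node_label n x S i = attach x S (i mod (2 * n))"

lemma node_label_upd: "v \<notin> S \<Longrightarrow> node_label n (x(v := u)) S = node_label n x S"
  by (auto simp: node_label_def attach_def fun_eq_iff)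

lemma cluster_sum_merge:
  assumes "u \<noteq> v" and "\<And>i. i < m \<Longrightarrow> f' i = (if f i = v then u else f i)"
  shows "cluster_sum m f' \<alpha> u = cluster_sum m f \<alpha> u + cluster_sum m f \<alpha> v"
proof -
  have "{i. i < m \<and> f' i = u} = {i. i < m \<and> f i = u} \<union> {i. i < m \<and> f i = v}"
    using assms by (auto split: if_splits)
  then show ?thesis
    unfolding cluster_sum_def using assms(1) by (simp add: sum.union_disjoint disjoint_iff)
qed

text \<open>The two kernels differ only at entries between the clusters \<open>u\<close> and
  \<open>v\<close>, so the output is the same on both. The bound is then the triangle inequality for
  (p + q - \<beta>) - (p - \<beta>) - (q - \<beta>) = \<beta>, with p and q the predictions on
  \<open>v\<close> and \<open>u\<close>.\<close>

lemma unqueried_merge_loss: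
  fixes f f' :: "nat \<Rightarrow> 'a"
  assumes "budgeted m B T" "u \<noteq> v" "\<beta> \<ge> 0"
    and f': "\<And>i. i < m \<Longrightarrow> f' i = (if f i = v then u else f i)"
    and unqueried: "\<nexists>i j. (i, j) \<in> set (queries T (label_kernel m f)) \<and> {f i, f j} = {u, v}"
  defines "\<alpha> \<equiv> run T (label_kernel m f)" and "\<alpha>' \<equiv> run T (label_kernel m f')"
  shows "\<beta> \<le> \<bar>cluster_sum m f \<alpha> v - \<beta>\<bar> + \<bar>cluster_sum m f \<alpha> u - \<beta>\<bar> + \<bar>cluster_sum m f' \<alpha>' u - \<beta>\<bar>"
proof -
  have "label_kernel m f' $$ p = label_kernel m f $$ p"
    if p: "p \<in> set (queries T (label_kernel m f))" for p
  proof -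
    obtain i j where ij: "p = (i, j)" by (cases p)
    have "i < m" "j < m" using budgeted_queries(2) [OF assms(1)] p ij by auto
    moreover have "{f i, f j} \<noteq> {u, v}" using unqueried p ij by blast
    ultimately show ?thesis using ij by (auto simp: f' insert_commute)
  qed
  then have "\<alpha>' = \<alpha>"
    unfolding \<alpha>_def \<alpha>'_def by (rule run_cong_queries)
  then have "cluster_sum m f' \<alpha>' u = cluster_sum m f \<alpha> u + cluster_sum m f \<alpha> v"
    using cluster_sum_merge [OF \<open>u \<noteq> v\<close> f'] by simp
  then show ?thesis by linarith
qed

text \<open>Each query meets at most one unordered pair of clusters. Since \<open>u < n\<close> and
  \<open>n \<le> v\<close>, the maximum and minimum of the two labels recover
  \<open>(v, u)\<close>.\<close>

lemma count_queried_pairs: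
  fixes f :: "nat \<Rightarrow> nat"
  assumes "finite W" "\<And>v. v \<in> W \<Longrightarrow> n \<le> v"
  shows "(\<Sum>v\<in>W. \<Sum>u<n. of_bool (\<exists>i j. (i, j) \<in> set Q \<and> {f i, f j} = {u, v})) \<le> real (length Q)"
proof -
  let ?H = "{(v, u). v \<in> W \<and> u < n \<and> (\<exists>i j. (i, j) \<in> set Q \<and> {f i, f j} = {u, v})}"
  have "(\<Sum>v\<in>W. \<Sum>u<n. of_bool (\<exists>i j. (i, j) \<in> set Q \<and> {f i, f j} = {u, v}))
      = (\<Sum>(v, u)\<in>W \<times> {..<n}. of_bool (\<exists>i j. (i, j) \<in> set Q \<and> {f i, f j} = {u, v}) :: real)"
    by (rule sum.cartesian_product)
  also have "\<dots> = (\<Sum>p\<in>W \<times> {..<n}. if p \<in> ?H then 1 else 0)"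
    by (intro sum.cong refl) (simp add: of_bool_def case_prod_unfold mem_Times_iff)
  also have "\<dots> = real (card {p \<in> W \<times> {..<n}. p \<in> ?H})"
    using assms by (subst sum.inter_filter [symmetric]) auto
  also have "{p \<in> W \<times> {..<n}. p \<in> ?H} = ?H" by auto
  also have "?H \<subseteq> (\<lambda>(i, j). (max (f i) (f j), min (f i) (f j))) ` set Q"
  proof clarify
    fix v u i j assume *: "v \<in> W" "u < n" "(i, j) \<in> set Q" "{f i, f j} = {u, v}"
    then have "u < v" using assms(2) [of v] by simp
    then have "(v, u) = (max (f i) (f j), min (f i) (f j))"
      using *(4) by (auto simp: doubleton_eq_iff)
    then show "(v, u) \<in> (\<lambda>(i, j). (max (f i) (f j), min (f i) (f j))) ` set Q"
      using *(3) by (auto intro!: image_eqI [of _ _ "(i, j)"])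
  qed
  then have "card ?H \<le> card ((\<lambda>(i, j). (max (f i) (f j), min (f i) (f j))) ` set Q)"
    by (intro card_mono) auto
  also have "\<dots> \<le> card (set Q)" by (rule card_image_le) simp
  also have "\<dots> \<le> length Q" by (rule card_length)
  finally show ?thesis by simp
qed

lemma total_node_loss_ge:
  fixes \<beta> :: real
  assumes T: "budgeted m B T" and "n > 0" "\<beta> \<ge> 0"
  defines "V \<equiv> {n..<2 * n}"
  defines "X \<equiv> V \<rightarrow>\<^sub>E {..<n}"
  defines "P \<equiv> \<lambda>x S. cluster_sum m (node_label n x S) (run T (label_kernel m (node_label n x S)))"
  shows "real (card X) * real (card (Pow V)) * \<beta> * (real n / 2 - real B / real n)
    \<le> (\<Sum>x\<in>X. \<Sum>S\<in>Pow V. \<Sum>w<2 * n. \<bar>P x S (attach x S w) - \<beta>\<bar>)"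
proof -
  define Q where "Q x S = queries T (label_kernel m (node_label n x S))" for x S
  define hit where "hit x S v u \<longleftrightarrow>
    (\<exists>i j. (i, j) \<in> set (Q x S) \<and> {node_label n x S i, node_label n x S j} = {u, v})" for x S v u
  \<comment> \<open>The residual at a candidate root \<open>u\<close>, with a penalty that pays for
    a query between \<open>v\<close> and \<open>u\<close>. The root is a separate argument so that
    it can be redrawn while the kernel stays fixed.\<close>
  define F where "F S v x u = \<bar>P x S u - \<beta>\<bar> + \<beta> * of_bool (hit x S v u)" for S v x u
  \<comment> \<open>\<open>R\<close>, \<open>A\<close> and \<open>J\<close> are the losses on the
    roots, the lone leaves and the attached leaves.\<close>
  define R where "R x S = (\<Sum>u<n. \<bar>P x S u - \<beta>\<bar>)" for x S
  define A where "A x S = (\<Sum>v\<in>V - S. \<bar>P x S v - \<beta>\<bar>)" for x S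
  define J where "J x S = (\<Sum>v\<in>S. \<bar>P x S (x v) - \<beta>\<bar>)" for x S
  have V: "finite V" "card V = n" by (simp_all add: V_def)
  have X: "x v < n" if "x \<in> X" "v \<in> V" for x v
    using that by (auto simp: X_def)
  have loss: "(\<Sum>w<2 * n. \<bar>P x S (attach x S w) - \<beta>\<bar>) = R x S + A x S + J x S"
    if "S \<in> Pow V" for x S
  proof -
    let ?g = "\<lambda>w. \<bar>P x S (attach x S w) - \<beta>\<bar>"
    have "sum ?g {..<2 * n} = sum ?g {..<n} + sum ?g V"
    proof -
      have "{..<2 * n} = {..<n} \<union> V" and "{..<n} \<inter> V = {}"
        by (auto simp: V_def)
      then show ?thesis using V by (simp add: sum.union_disjoint)
    qed
    moreover have "sum ?g V = sum ?g (V - S) + sum ?g S"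
      using that V by (intro sum.subset_diff) auto
    moreover have "(\<Sum>w<n. \<bar>P x S (attach x S w) - \<beta>\<bar>) = R x S"
      unfolding R_def using that by (intro sum.cong) (auto simp: attach_def V_def)
    moreover have "(\<Sum>w\<in>V - S. \<bar>P x S (attach x S w) - \<beta>\<bar>) = A x S"
      unfolding A_def by (intro sum.cong) (auto simp: attach_def)
    moreover have "(\<Sum>w\<in>S. \<bar>P x S (attach x S w) - \<beta>\<bar>) = J x S"
      unfolding J_def by (intro sum.cong) (auto simp: attach_def)
    ultimately show ?thesis by simp
  qed
  \<comment> \<open>If the pair was queried, the penalty in \<open>F\<close> alone gives \<beta>;
    otherwise the merging inequality applies.\<close>
  have swap: "\<beta> \<le> \<bar>P x S v - \<beta>\<bar> + F S v x (x v) + \<bar>P x (insert v S) (x v) - \<beta>\<bar>"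
    if "x \<in> X" "S \<in> Pow V" "v \<in> V - S" for x S v
  proof (cases "hit x S v (x v)")
    case True
    then show ?thesis by (simp add: F_def)
  next
    case False
    have "x v < n" using that X by auto
    moreover have "n \<le> v" using that by (simp add: V_def)
    \<comment> \<open>Roots lie below \<open>n\<close>, so no attached leaf carries the label
      \<open>v\<close>, and attaching \<open>v\<close> relabels exactly its own class.\<close>
    moreover have "x w \<noteq> v" if "w \<in> S" for w
      using X [of x w] \<open>x \<in> X\<close> \<open>S \<in> Pow V\<close> \<open>n \<le> v\<close> that by auto
    then have "node_label n x (insert v S) i
        = (if node_label n x S i = v then x v else node_label n x S i)" for i
      by (auto simp: node_label_def attach_def)
    ultimately show ?thesis
      using unqueried_merge_loss [OF T, of "x v" v \<beta> "node_label n x (insert v S)" "node_label n x S"]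
        False \<open>\<beta> \<ge> 0\<close>
      by (simp add: P_def F_def hit_def Q_def)
  qed
  have F_average: "real n * (\<Sum>x\<in>X. F S v x (x v)) = (\<Sum>x\<in>X. \<Sum>u<n. F S v x u)"
    if "v \<in> V - S" for S v
  proof -
    have "F S v (x(v := u)) = F S v x" for x u
      using that by (intro ext) (simp add: F_def hit_def Q_def P_def node_label_upd)
    then show ?thesis
      using sum_PiE_resample [of v V "{..<n}" "F S v"] that by (simp add: X_def)
  qed
  \<comment> \<open>At most \<open>n\<close> lone leaves each see the whole root loss, and the
    penalties number at most one per query.\<close>
  have F_bound: "(\<Sum>v\<in>V - S. \<Sum>u<n. F S v x u) \<le> real n * R x S + \<beta> * real B"
    if "S \<in> Pow V" for x S
  proof -
    have "(\<Sum>v\<in>V - S. \<Sum>u<n. F S v x u)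
        = real (card (V - S)) * R x S + \<beta> * (\<Sum>v\<in>V - S. \<Sum>u<n. of_bool (hit x S v u))"
      by (simp add: F_def R_def sum.distrib sum_distrib_left mult.commute)
    also have "\<dots> \<le> real n * R x S + \<beta> * real B"
    proof (intro add_mono mult_mono)
      show "real (card (V - S)) \<le> real n"
        using V by (metis card_mono Diff_subset of_nat_le_iff)
      have "(\<Sum>v\<in>V - S. \<Sum>u<n. of_bool (hit x S v u)) \<le> real (length (Q x S))"
        unfolding hit_def by (rule count_queried_pairs) (auto simp: V_def)
      also have "\<dots> \<le> real B"
        using budgeted_queries(1) [OF T] by (simp add: Q_def)
      finally show "(\<Sum>v\<in>V - S. \<Sum>u<n. of_bool (hit x S v u)) \<le> real B" .
    qed (auto simp: R_def \<open>\<beta> \<ge> 0\<close> sum_nonneg)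
    finally show ?thesis .
  qed
  have "real n * (\<Sum>x\<in>X. \<Sum>S\<in>Pow V. \<Sum>v\<in>V - S. F S v x (x v))
      = (\<Sum>S\<in>Pow V. \<Sum>v\<in>V - S. real n * (\<Sum>x\<in>X. F S v x (x v)))"
    by (subst sum.swap) (simp add: sum_distrib_left sum.swap [of _ X])
  also have "\<dots> = (\<Sum>S\<in>Pow V. \<Sum>v\<in>V - S. \<Sum>x\<in>X. \<Sum>u<n. F S v x u)"
    by (intro sum.cong refl F_average)
  also have "\<dots> = (\<Sum>x\<in>X. \<Sum>S\<in>Pow V. \<Sum>v\<in>V - S. \<Sum>u<n. F S v x u)"
    by (subst (2) sum.swap) (simp add: sum.swap [of _ X])
  also have "\<dots> \<le> (\<Sum>x\<in>X. \<Sum>S\<in>Pow V. real n * R x S + \<beta> * real B)"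
    by (intro sum_mono F_bound)
  also have "\<dots> = real n * ((\<Sum>x\<in>X. \<Sum>S\<in>Pow V. R x S)
      + real (card X) * real (card (Pow V)) * \<beta> * (real B / real n))"
    using \<open>n > 0\<close> by (simp add: sum.distrib sum_distrib_left algebra_simps)
  finally have middle: "(\<Sum>x\<in>X. \<Sum>S\<in>Pow V. \<Sum>v\<in>V - S. F S v x (x v))
      \<le> (\<Sum>x\<in>X. \<Sum>S\<in>Pow V. R x S) + real (card X) * real (card (Pow V)) * \<beta> * (real B / real n)"
    using \<open>n > 0\<close> by simp
  \<comment> \<open>The inequality \<open>swap\<close> is now summed over all \<open>x\<close>,
    \<open>S\<close> and lone \<open>v\<close>; the left side contributes \<beta> for each of the
    n/2 lone leaves present on average.\<close>
  have "real (card X) * real (card (Pow V)) * \<beta> * (real n / 2)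
      = real (card X) * \<beta> * (\<Sum>S\<in>Pow V. real (card (V - S)))"
    using sum_card_Diff_Pow [OF V(1)] V(2) by (simp add: field_simps)
  also have "\<dots> = (\<Sum>x\<in>X. \<Sum>S\<in>Pow V. \<Sum>v\<in>V - S. \<beta>)"
    by (simp add: sum_distrib_left sum_distrib_right mult_ac)
  also have "\<dots> \<le> (\<Sum>x\<in>X. \<Sum>S\<in>Pow V. \<Sum>v\<in>V - S.
      \<bar>P x S v - \<beta>\<bar> + F S v x (x v) + \<bar>P x (insert v S) (x v) - \<beta>\<bar>)"
    by (intro sum_mono swap)
  also have "\<dots> = (\<Sum>x\<in>X. \<Sum>S\<in>Pow V. A x S) + (\<Sum>x\<in>X. \<Sum>S\<in>Pow V. \<Sum>v\<in>V - S. F S v x (x v))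
      + (\<Sum>x\<in>X. \<Sum>S\<in>Pow V. \<Sum>v\<in>V - S. \<bar>P x (insert v S) (x v) - \<beta>\<bar>)"
    by (simp add: sum.distrib A_def)
  \<comment> \<open>Moving \<open>v\<close> into the set turns its residual after attachment into a
    summand of \<open>J\<close>.\<close>
  also have "(\<Sum>x\<in>X. \<Sum>S\<in>Pow V. \<Sum>v\<in>V - S. \<bar>P x (insert v S) (x v) - \<beta>\<bar>)
      = (\<Sum>x\<in>X. \<Sum>S\<in>Pow V. J x S)"
    unfolding J_def by (intro sum.cong refl sum_Pow_insert V(1))
  finally have "real (card X) * real (card (Pow V)) * \<beta> * (real n / 2)
      - real (card X) * real (card (Pow V)) * \<beta> * (real B / real n)
      \<le> (\<Sum>x\<in>X. \<Sum>S\<in>Pow V. R x S + A x S + J x S)"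
    using middle by (simp add: sum.distrib)
  then show ?thesis
    by (simp add: loss right_diff_distrib)
qed

section \<open>Average loss over the points and the loss of the competitor\<close>

lemma avg_loss_label_kernel:
  "avg_loss m (label_kernel m f) (vec m (\<lambda>_. \<beta>)) \<alpha>
    = (1 / real m) * (\<Sum>t<m. \<bar>cluster_sum m f \<alpha> (f t) - \<beta>\<bar>)"
  unfolding avg_loss_def by (simp add: scalar_prod_label_kernel)

lemma avg_loss_nonneg: "avg_loss m K y \<alpha> \<ge> 0"
  by (simp add: avg_loss_def sum_nonneg)

text \<open>Weight \<beta> on one representative of each cluster predicts \<beta> everywhere. There
  are at most \<open>2 * n\<close> clusters, so the quadratic form is at most 2 n \<beta>^2 = 2,
  which dictates \<beta> = 1 / sqrt n.\<close>

lemma best_loss_node_label: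
  assumes "0 < n" "2 * n \<le> m" "x \<in> {n..<2 * n} \<rightarrow>\<^sub>E {..<n}" "S \<subseteq> {n..<2 * n}"
  shows "best_loss m (label_kernel m (node_label n x S)) (vec m (\<lambda>_. 1 / sqrt n)) \<le> 0"
proof -
  define f where "f = node_label n x S"
  define \<beta> where "\<beta> = 1 / sqrt n"
  define a where "a = vec m (\<lambda>t. if t < 2 * n \<and> f t = t then \<beta> else 0)"
  \<comment> \<open>Roots are never in \<open>S\<close>, so labelling is idempotent and each label
    is itself a point of its cluster: the representative that carries the weight.\<close>
  have range: "f t < 2 * n \<and> f (f t) = f t" for t
  proof -
    have "t mod (2 * n) < 2 * n" using \<open>0 < n\<close> by simp
    moreover have "x w < n" if "w \<in> S" for w using that assms(3,4) by auto
    moreover have "x w \<notin> S" if "w \<in> S" for w using calculation(2) [OF that] assms(4) by auto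
    ultimately show ?thesis
      by (auto simp: f_def node_label_def attach_def mod_less intro: order_less_trans [of _ n])
        (metis \<open>0 < n\<close> add_lessD1 mod_less mult_2 trans_less_add1)+
  qed
  have pred: "cluster_sum m f a (f t) = \<beta>" if "t < m" for t
  proof -
    have "cluster_sum m f a (f t) = (\<Sum>i\<in>{i. i < m \<and> f i = f t}. if i = f t then \<beta> else 0)"
      unfolding cluster_sum_def a_def using range by (intro sum.cong) auto
    also have "\<dots> = \<beta>"
      using range [of t] assms(2) by (subst sum.delta) auto
    finally show ?thesis .
  qed
  have "a \<bullet> (label_kernel m f *\<^sub>v a) = (\<Sum>t<m. a $ t * cluster_sum m f a (f t))"
  proof -
    have "a \<bullet> (label_kernel m f *\<^sub>v a) = (\<Sum>t<m. a $ t * (\<Sum>i<m. of_bool (f t = f i) * a $ i))"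
      by (simp add: scalar_prod_def atLeast0LessThan label_kernel_def a_def)
    also have "\<dots> = (\<Sum>t<m. a $ t * cluster_sum m f a (f t))"
    proof (intro sum.cong refl arg_cong2 [where f = "(*)"])
      fix t
      have "(\<Sum>i<m. of_bool (f t = f i) * a $ i) = (\<Sum>i<m. if f i = f t then a $ i else 0)"
        by (intro sum.cong) auto
      also have "\<dots> = cluster_sum m f a (f t)"
        unfolding cluster_sum_def by (subst sum.inter_filter [symmetric]) auto
      finally show "(\<Sum>i<m. of_bool (f t = f i) * a $ i) = cluster_sum m f a (f t)" .
    qed
    finally show ?thesis .
  qed
  also have "\<dots> = (\<Sum>t<m. a $ t * \<beta>)" by (simp add: pred)
  also have "\<dots> \<le> (\<Sum>t<m. if t < 2 * n then \<beta> * \<beta> else 0)"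
    by (intro sum_mono) (auto simp: a_def)
  also have "\<dots> = (\<Sum>t<2 * n. \<beta> * \<beta>)"
    using assms(2) by (intro sum.mono_neutral_cong_right) auto
  also have "\<dots> = 2"
    using \<open>0 < n\<close> by (simp add: \<beta>_def)
  finally have "a \<in> {a \<in> carrier_vec m. a \<bullet> (label_kernel m f *\<^sub>v a) \<le> 2}"
    by (simp add: a_def)
  moreover have "bdd_below (avg_loss m (label_kernel m f) y ` {a \<in> carrier_vec m. a \<bullet> (label_kernel m f *\<^sub>v a) \<le> 2})" for y
    by (rule bdd_belowI [of _ 0]) (auto simp: avg_loss_nonneg)
  ultimately have "best_loss m (label_kernel m f) y \<le> avg_loss m (label_kernel m f) y a" for y
    unfolding best_loss_def by (intro cINF_lower)
  also have "avg_loss m (label_kernel m f) (vec m (\<lambda>_. \<beta>)) a = 0"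
    by (simp add: avg_loss_label_kernel pred)
  finally show ?thesis by (simp add: f_def \<beta>_def)
qed

lemma total_avg_loss_ge:
  fixes \<beta> :: real
  assumes T: "budgeted m B T" and "n > 0" "2 * n \<le> m" "\<beta> \<ge> 0" "real B \<le> (real n)\<^sup>2 / 4"
  defines "V \<equiv> {n..<2 * n}"
  defines "X \<equiv> V \<rightarrow>\<^sub>E {..<n}"
  shows "real (card (X \<times> Pow V)) * (\<beta> / 16) \<le> (\<Sum>(x, S)\<in>X \<times> Pow V.
    avg_loss m (label_kernel m (node_label n x S)) (vec m (\<lambda>_. \<beta>))
      (run T (label_kernel m (node_label n x S))))"
proof -
  define P where
    "P x S = cluster_sum m (node_label n x S) (run T (label_kernel m (node_label n x S)))" for x S
  define N where "N = real (card X) * real (card (Pow V)) * \<beta>"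
  have N: "N \<ge> 0" using \<open>\<beta> \<ge> 0\<close> by (simp add: N_def)
  \<comment> \<open>Because \<open>2 * n \<le> m\<close>, rounding m / (2 n) down loses at most a
    factor 2.\<close>
  have "real m \<le> 4 * real n * real (m div (2 * n))"
  proof -
    have "m div (2 * n) \<ge> 1" using assms by (simp add: div_greater_zero_iff Suc_leI)
    moreover have "m < 2 * n * (m div (2 * n)) + 2 * n"
      using \<open>n > 0\<close> by (metis dividend_less_times_div add.commute mult_pos_pos zero_less_numeral)
    moreover have "2 * n * (m div (2 * n)) \<ge> 2 * n" using calculation(1) by simp
    ultimately have "m \<le> 4 * n * (m div (2 * n))" by linarith
    then show ?thesis by (metis of_nat_le_iff of_nat_mult of_nat_numeral)
  qed
  then have div: "real (m div (2 * n)) / real m \<ge> 1 / (4 * real n)"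
    using assms by (simp add: field_simps)
  have "real n / 2 - real B / real n \<ge> real n / 4"
    using assms by (simp add: field_simps power2_eq_square)
  then have "N * (real n / 4) \<le> N * (real n / 2 - real B / real n)"
    using N by (intro mult_left_mono)
  also have "\<dots> \<le> (\<Sum>x\<in>X. \<Sum>S\<in>Pow V. \<Sum>w<2 * n. \<bar>P x S (attach x S w) - \<beta>\<bar>)"
    unfolding N_def P_def X_def V_def using assms by (intro total_node_loss_ge)
  finally have total: "N * (real n / 4) \<le> (\<Sum>x\<in>X. \<Sum>S\<in>Pow V. \<Sum>w<2 * n. \<bar>P x S (attach x S w) - \<beta>\<bar>)" .
  \<comment> \<open>The 16 is the product of the 4 lost to averaging over the points and the 4 in
    n/4, which is what the budget leaves of n/2.\<close>
  have "real (card (X \<times> Pow V)) * (\<beta> / 16) = 1 / (4 * real n) * (N * (real n / 4))"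
    using \<open>n > 0\<close> by (simp add: N_def card_cartesian_product)
  also have "\<dots> \<le> real (m div (2 * n)) / real m * (N * (real n / 4))"
    using N by (intro mult_right_mono div) simp
  also have "\<dots> \<le> real (m div (2 * n)) / real m *
      (\<Sum>x\<in>X. \<Sum>S\<in>Pow V. \<Sum>w<2 * n. \<bar>P x S (attach x S w) - \<beta>\<bar>)"
    by (intro mult_left_mono total) simp
  also have "\<dots> = (\<Sum>x\<in>X. \<Sum>S\<in>Pow V. 1 / real m *
      (real (m div (2 * n)) * (\<Sum>w<2 * n. \<bar>P x S (attach x S w) - \<beta>\<bar>)))"
    by (simp add: sum_distrib_left)
  also have "\<dots> \<le> (\<Sum>x\<in>X. \<Sum>S\<in>Pow V. 1 / real m *
      (\<Sum>t<m. \<bar>P x S (attach x S (t mod (2 * n))) - \<beta>\<bar>))"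
    by (intro sum_mono mult_left_mono sum_mod_ge) auto
  finally show ?thesis
    by (simp add: avg_loss_label_kernel P_def node_label_def sum.cartesian_product)
qed

section \<open>Randomized algorithms and the choice of one hard kernel\<close>

lemma borel_measurable_avg_loss:
  assumes "budgeted_algorithm m B M" "K \<in> carrier_mat m m" "y \<in> carrier_vec m"
  shows "(\<lambda>A. avg_loss m K y (run (A y) K)) \<in> borel_measurable M"
proof -
  have [measurable]: "(\<lambda>A. run (A y) K $ i) \<in> borel_measurable M" if "i < m" for i
    using assms that unfolding budgeted_algorithm_def by blast
  have "(\<lambda>A. run (A y) K \<bullet> (K *\<^sub>v unit_vec m t)) \<in> borel_measurable M" for t
    unfolding scalar_prod_def using assms by (intro borel_measurable_sum borel_measurable_times) auto
  then show ?thesis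
    unfolding avg_loss_def by measurable
qed

lemma ennreal_sum_ge_imp_ex:
  fixes f :: "'a \<Rightarrow> ennreal"
  assumes "finite H" "H \<noteq> {}" "(\<Sum>h\<in>H. b) \<le> (\<Sum>h\<in>H. f h)"
  shows "\<exists>h\<in>H. b \<le> f h"
proof -
  have "Max (f ` H) \<in> f ` H" using assms by (intro Max_in) auto
  then obtain h where h: "h \<in> H" "f h = Max (f ` H)" by auto
  have "of_nat (card H) * b \<le> (\<Sum>h\<in>H. f h)" using assms(3) by simp
  also have "\<dots> \<le> (\<Sum>h'\<in>H. f h)" using assms(1) h by (intro sum_mono) simp
  finally have "of_nat (card H) * b \<le> of_nat (card H) * f h" by simp
  then have "b \<le> f h"
    using assms by (subst (asm) ennreal_mult_le_mult_iff) auto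
  with h show ?thesis by blast
qed

text \<open>The targets are common to the whole family, so each \<open>A\<close> is one fixed query
  tree \<open>A y\<close> against all its kernels. The summed bound holds for every such tree;
  integrating it and exchanging integral and finite sum yields a kernel that depends on
  \<open>M\<close> only.\<close>

lemma exists_hard_kernel:
  assumes M: "budgeted_algorithm m B M" and "n > 0" "2 * n \<le> m" "real B \<le> (real n)\<^sup>2 / 4"
  defines "y \<equiv> vec m (\<lambda>_. 1 / sqrt n)"
  shows "\<exists>K\<in>cluster_kernels (2 * m) m.
    expected_loss m M K y \<ge> ennreal (best_loss m K y + 1 / (16 * sqrt n))"
proof -
  interpret prob_space M using M by (simp add: budgeted_algorithm_def)
  define V where "V = {n..<2 * n}"
  define H where "H = (V \<rightarrow>\<^sub>E {..<n}) \<times> Pow V"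
  define K where "K = (\<lambda>(x, S). label_kernel m (node_label n x S))"
  define b where "b = 1 / (16 * sqrt n)"
  have "b \<ge> 0" by (simp add: b_def)
  have H: "finite H" "H \<noteq> {}"
    using \<open>n > 0\<close> by (auto simp: H_def V_def PiE_eq_empty_iff intro!: finite_PiE)
  have [simp]: "K h \<in> carrier_mat m m" for h by (simp add: K_def split: prod.split)
  have [simp]: "y \<in> carrier_vec m" by (simp add: y_def)
  have "\<exists>h\<in>H. expected_loss m M (K h) y \<ge> ennreal b"
  proof (rule ennreal_sum_ge_imp_ex [OF H])
    have "(\<Sum>h\<in>H. ennreal b) = ennreal (real (card H) * b)"
      using \<open>b \<ge> 0\<close> by (simp add: ennreal_mult ennreal_of_nat_eq_real_of_nat)
    also have "\<dots> = (\<integral>\<^sup>+ A. ennreal (real (card H) * b) \<partial>M)"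
      by (simp add: emeasure_space_1)
    also have "\<dots> \<le> (\<integral>\<^sup>+ A. (\<Sum>h\<in>H. ennreal (avg_loss m (K h) y (run (A y) (K h)))) \<partial>M)"
    proof (rule nn_integral_mono)
      fix A assume "A \<in> space M"
      then have "budgeted m B (A y)" using M by (simp add: budgeted_algorithm_def)
      then have "real (card H) * b \<le> (\<Sum>h\<in>H. avg_loss m (K h) y (run (A y) (K h)))"
        using total_avg_loss_ge [of m B "A y" n "1 / sqrt n"] assms
        by (simp add: H_def V_def K_def b_def y_def case_prod_unfold)
      then show "ennreal (real (card H) * b)
          \<le> (\<Sum>h\<in>H. ennreal (avg_loss m (K h) y (run (A y) (K h))))"
        by (simp add: avg_loss_nonneg sum_ennreal ennreal_leI)
    qed
    also have "\<dots> = (\<Sum>h\<in>H. expected_loss m M (K h) y)"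
      unfolding expected_loss_def using borel_measurable_avg_loss [OF M]
      by (intro nn_integral_sum) simp
    finally show "(\<Sum>h\<in>H. ennreal b) \<le> (\<Sum>h\<in>H. expected_loss m M (K h) y)" .
  qed
  then obtain x S where xS: "(x, S) \<in> H" "expected_loss m M (K (x, S)) y \<ge> ennreal b" by auto
  have "best_loss m (K (x, S)) y \<le> 0"
    using best_loss_node_label [of n m x S] xS(1) assms by (simp add: H_def V_def K_def y_def)
  then have "ennreal (best_loss m (K (x, S)) y + b) \<le> ennreal b"
    by (intro ennreal_leI) simp
  then have "expected_loss m M (K (x, S)) y \<ge> ennreal (best_loss m (K (x, S)) y + b)"
    using xS(2) by (rule order_trans)
  moreover have "K (x, S) \<in> cluster_kernels (2 * m) m"
    by (simp add: K_def label_kernel_in_cluster_kernels)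
  ultimately show ?thesis unfolding b_def by blast
qed

theorem corollary1:
  shows "\<exists>c c' :: real. c > 0 \<and> c' > 0 \<and>
    (\<forall>m B :: nat. m > 0 \<and> B > 0 \<and> real B \<le> c * (real m)^2 \<longrightarrow>
      (\<forall>M :: (real vec \<Rightarrow> query_tree) measure. budgeted_algorithm m B M \<longrightarrow>
        (\<exists>d K y. K \<in> cluster_kernels (2 * d) m \<and>
           y \<in> carrier_vec m \<and> (\<forall>t<m. y $ t \<in> {-1..1}) \<and>
           expected_loss m M K y \<ge> ennreal (best_loss m K y + c' / root 4 (real B)))))"
proof (rule exI [of _ "1 / 36"], rule exI [of _ "1 / 32"], intro conjI allI impI)
  fix m B :: nat and M :: "(real vec \<Rightarrow> query_tree) measure"
  assume mB: "m > 0 \<and> B > 0 \<and> real B \<le> 1 / 36 * (real m)^2" and M: "budgeted_algorithm m B M"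
  \<comment> \<open>Rounding 2 sqrt B up secures \<open>B \<le> n\<^sup>2 / 4\<close>, and costs at
    most 1, hence at most sqrt B.\<close>
  define n where "n = nat \<lceil>2 * sqrt B\<rceil>"
  have "sqrt B \<ge> 1" using mB by simp
  then have n: "2 * sqrt B \<le> n" "n \<le> 3 * sqrt B" unfolding n_def by linarith+
  \<comment> \<open>The constant 1/36 is chosen so that 2 n \<le> 6 sqrt B \<le> m.\<close>
  have "sqrt B \<le> sqrt ((real m / 6)\<^sup>2)"
    using mB by (intro real_sqrt_le_mono) (simp add: power_divide)
  then have "sqrt B \<le> real m / 6" by simp
  then have "2 * n \<le> m" using n by linarith
  have "n > 0" using n \<open>sqrt B \<ge> 1\<close> by (cases n) auto
  have "real B = (2 * sqrt B)\<^sup>2 / 4" by (simp add: power_mult_distrib)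
  also have "\<dots> \<le> (real n)\<^sup>2 / 4"
    using n by (intro divide_right_mono power_mono) auto
  finally obtain K where K: "K \<in> cluster_kernels (2 * m) m"
    "expected_loss m M K (vec m (\<lambda>_. 1 / sqrt n))
      \<ge> ennreal (best_loss m K (vec m (\<lambda>_. 1 / sqrt n)) + 1 / (16 * sqrt n))"
    using exists_hard_kernel [OF M \<open>n > 0\<close> \<open>2 * n \<le> m\<close>] by blast
  have "root 4 (real B) = sqrt (sqrt B)"
    using real_root_mult_exp [of 2 2 "real B"] by (simp add: sqrt_def)
  \<comment> \<open>Relaxing 3 to 4 gives the clean bound of sqrt n by twice the fourth root of B,
    whence 32 = 16 * 2.\<close>
  moreover have "sqrt n \<le> sqrt (4 * sqrt B)"
    using n \<open>sqrt B \<ge> 1\<close> by (intro real_sqrt_le_mono) simp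
  moreover have "sqrt (4 * sqrt B) = 2 * sqrt (sqrt B)"
    by (simp add: real_sqrt_mult)
  ultimately have "16 * sqrt n \<le> 32 * root 4 (real B)" by simp
  then have "1 / 32 / root 4 (real B) \<le> 1 / (16 * sqrt n)"
    using mB \<open>n > 0\<close> by (simp add: frac_le)
  then have "ennreal (best_loss m K (vec m (\<lambda>_. 1 / sqrt n)) + 1 / 32 / root 4 (real B))
      \<le> expected_loss m M K (vec m (\<lambda>_. 1 / sqrt n))"
    using K(2) by (meson add_left_mono ennreal_leI order_trans)
  moreover have "1 / sqrt n \<le> 1" "- 1 \<le> 1 / sqrt n"
    using \<open>n > 0\<close> by (simp_all add: order_trans [of "- 1" 0])
  ultimately show "\<exists>d K y. K \<in> cluster_kernels (2 * d) m \<and>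
           y \<in> carrier_vec m \<and> (\<forall>t<m. y $ t \<in> {-1..1}) \<and>
           expected_loss m M K y \<ge> ennreal (best_loss m K y + 1 / 32 / root 4 (real B))"
    using K(1) by (intro exI [of _ m] exI [of _ K] exI [of _ "vec m (\<lambda>_. 1 / sqrt n)"]) auto
qed simp_all

end
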